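(* Let $(J_n)_{n\ge 0}$ and $(JL_n)_{n\ge 0}$ be the Jacobsthal and Jacobsthal-Lucas numbers, and for $n\ge 0$ let $$HSJ_n=\begin{bmatrix} J_n+jJ_{n+3}\\ -J_{n+1}+jJ_{n+2}\end{bmatrix},\qquad HSJL_n=\begin{bmatrix} JL_n+jJL_{n+3}\\ -JL_{n+1}+jJL_{n+2}\end{bmatrix}.$$ Then for all $n\ge 1$, $$JL_n\,HSJ_n+2\,JL_{n-1}\,HSJ_{n-1}=HSJL_{2n-1},$$ where $JL_n\,HSJ_n$ denotes the spinor $HSJ_n$ multiplied by the real scalar $JL_n$.
   Context: The Jacobsthal numbers: $J_0=0$, $J_1=1$, $J_{n+2}=J_{n+1}+2J_n$. The Jacobsthal-Lucas numbers: $JL_0=2$, $JL_1=1$, $JL_{n+2}=JL_{n+1}+2JL_n$. Here $j$ is the hyperbolic unit ($j^2=1$, $j\neq\pm1$); spinors are column vectors with two hyperbolic-number entries, added and multiplied by real scalars componentwise. *)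

theory Defs
  imports "HOL-Analysis.Cartesian_Space"
begin

fun jacobsthal :: "nat \<Rightarrow> nat" where
  "jacobsthal 0 = 0"
| "jacobsthal (Suc 0) = 1"
| "jacobsthal (Suc (Suc n)) = jacobsthal (Suc n) + 2 * jacobsthal n"

fun jacobsthal_lucas :: "nat \<Rightarrow> nat" where
  "jacobsthal_lucas 0 = 2"
| "jacobsthal_lucas (Suc 0) = 1"
| "jacobsthal_lucas (Suc (Suc n)) = jacobsthal_lucas (Suc n) + 2 * jacobsthal_lucas n"

text \<open>\<open>Hyperbolic a b\<close> is the hyperbolic (split-complex) number \<open>a + j b\<close>.\<close>

datatype hyperbolic = Hyperbolic (hre: real) (him: real)

lemma hyperbolic_eq_iff: "x = y \<longleftrightarrow> hre x = hre y \<and> him x = him y"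
  by (cases x; cases y) simp

instantiation hyperbolic :: real_algebra_1
begin

definition zero_hyperbolic where "0 = Hyperbolic 0 0"
definition one_hyperbolic where "1 = Hyperbolic 1 0"
definition plus_hyperbolic where
  "x + y = Hyperbolic (hre x + hre y) (him x + him y)"
definition uminus_hyperbolic where "- x = Hyperbolic (- hre x) (- him x)"
definition minus_hyperbolic where
  "x - y = Hyperbolic (hre x - hre y) (him x - him y)"
definition times_hyperbolic where
  "x * y = Hyperbolic (hre x * hre y + him x * him y) (hre x * him y + him x * hre y)"
definition scaleR_hyperbolic where
  "r *\<^sub>R x = Hyperbolic (r * hre x) (r * him x)"

lemmas hyperbolic_defs = zero_hyperbolic_def one_hyperbolic_def plus_hyperbolic_def
  uminus_hyperbolic_def minus_hyperbolic_def times_hyperbolic_def scaleR_hyperbolic_def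

instance
  by standard (simp_all add: hyperbolic_defs hyperbolic_eq_iff algebra_simps)

end

instance hyperbolic :: comm_ring_1
  by standard (simp_all add: hyperbolic_defs hyperbolic_eq_iff algebra_simps)

definition hyp_j :: hyperbolic where
  "hyp_j = Hyperbolic 0 1"

lemma hyp_j_square: "hyp_j ^ 2 = 1"
  by (simp add: hyp_j_def power2_eq_square hyperbolic_defs)

lemma hyp_j_neq: "hyp_j \<noteq> 1" "hyp_j \<noteq> - 1"
  by (simp_all add: hyp_j_def hyperbolic_defs)

lemma Hyperbolic_eq: "Hyperbolic a b = of_real a + hyp_j * of_real b"
  by (simp add: hyp_j_def of_real_def hyperbolic_defs)

type_synonym hyp_spinor = "hyperbolic ^ 2"

definition HSJ :: "nat \<Rightarrow> hyp_spinor" where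
  "HSJ n = vector
    [of_nat (jacobsthal n) + hyp_j * of_nat (jacobsthal (n + 3)),
     - of_nat (jacobsthal (n + 1)) + hyp_j * of_nat (jacobsthal (n + 2))]"

definition HSJL :: "nat \<Rightarrow> hyp_spinor" where
  "HSJL n = vector
    [of_nat (jacobsthal_lucas n) + hyp_j * of_nat (jacobsthal_lucas (n + 3)),
     - of_nat (jacobsthal_lucas (n + 1)) + hyp_j * of_nat (jacobsthal_lucas (n + 2))]"

end

theory Submission
  imports Defs
begin

text \<open>Each coordinate of either spinor is a combination, with coefficients \<open>1\<close>,
  \<open>-1\<close> or \<open>hyp_j\<close>, of sequence values at a shift i in {0,1,2,3}. Hence the
  theorem reduces to one scalar identity, the addition formula \<open>jacobsthal_lucas_add\<close>,
  taken at k = m + i with n = m + 1.\<close>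

lemma jacobsthal_lucas_add:
  "jacobsthal_lucas (Suc m) * jacobsthal (Suc k) + 2 * jacobsthal_lucas m * jacobsthal k
     = jacobsthal_lucas (Suc (m + k))"
proof (induction k arbitrary: m)
  case 0
  show ?case by simp
next
  case (Suc k)
  \<comment> \<open>Expanding J_{k+2} = J_{k+1} + 2 J_k and collecting J_{k+1} produces JL_{m+2} as
    its coefficient: one index step moves from k to m, hence the general m.\<close>
  show ?case using Suc.IH[of "Suc m"] by (simp add: algebra_simps)
qed

lemma of_nat_jacobsthal_lucas_add:
  "real (jacobsthal_lucas (Suc m)) *\<^sub>R (of_nat (jacobsthal (Suc k)) :: hyperbolic)
     + (2 * real (jacobsthal_lucas m)) *\<^sub>R of_nat (jacobsthal k)
     = of_nat (jacobsthal_lucas (Suc (m + k)))"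
  unfolding jacobsthal_lucas_add[symmetric] by (simp add: scaleR_conv_of_real)

theorem theorem3p14:
  fixes n :: nat
  assumes "n \<ge> 1"
  shows "real (jacobsthal_lucas n) *\<^sub>R HSJ n
           + (2 * real (jacobsthal_lucas (n - 1))) *\<^sub>R HSJ (n - 1)
         = HSJL (2 * n - 1)"
proof -
  obtain m where n: "n = Suc m"
    using assms by (cases n) auto
  define a b where "a = real (jacobsthal_lucas (Suc m))" and "b = 2 * real (jacobsthal_lucas m)"
  \<comment> \<open>The addition formula for all four shifts at once, with coefficients independent
    of i.\<close>
  have split: "of_nat (jacobsthal_lucas (2 * n - 1 + i))
      = a *\<^sub>R (of_nat (jacobsthal (n + i)) :: hyperbolic) + b *\<^sub>R of_nat (jacobsthal (m + i))" for i
  proof -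
    have "2 * n - 1 + i = Suc (m + (m + i))" "n + i = Suc (m + i)"
      using n by auto
    then show ?thesis
      unfolding a_def b_def by (simp only: of_nat_jacobsthal_lucas_add)
  qed
  have "a *\<^sub>R HSJ n + b *\<^sub>R HSJ m = HSJL (2 * n - 1)"
    \<comment> \<open>Shift 0 appears without a summand, so it needs its own instance. With the
      values of J kept opaque, only linear algebra in each coordinate remains.\<close>
    unfolding HSJ_def HSJL_def split split[of 0, unfolded add_0_right]
    by (simp add: vec_eq_iff forall_2 algebra_simps del: jacobsthal.simps)
  then show ?thesis
    by (simp add: n a_def b_def)
qed

end
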